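(* Let $M$ be an orientable compact hypersurface of $\mathbb{S}^{7}$ with constant mean curvature and let $\gamma:M\to\mathbb{S}^{6}$ be its (octonionic) Gauss map, $\gamma(x)=x^{-1}\cdot\eta(x)$, where $\eta$ is a unit normal vector field along $M$. Then $\gamma(M)$ is not contained in any open hemisphere of $\mathbb{S}^{6}$.
   Context: $\mathbb{S}^7$ is the unit sphere of $\mathbb{R}^8$ identified with the octonions; $\cdot$ is octonionic multiplication, with unit $1\in\mathbb{S}^7$. For $v\in T_x\mathbb{S}^7$ one has $x^{-1}\cdot v\in T_1\mathbb{S}^7$. $\mathbb{S}^6$ is the unit sphere centered at the origin of $T_1\mathbb{S}^7\cong\mathbb{R}^7$. An open hemisphere of $\mathbb{S}^6$ is a set $\{u\in\mathbb{S}^6:\langle u,v\rangle>0\}$ for some $v\in\mathbb{S}^6$. Compact hypersurfaces are without boundary (and nonempty). Constant mean curvature means that the mean curvature function of $M$ with respect to $\eta$ is constant. *)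

theory Defs
  imports "HOL-Analysis.Analysis"
begin

section \<open>Octonions\<close>

text \<open>
  The octonions are \<open>\<real>\<^sup>8\<close> with coordinates indexed by \<open>0, \<dots>, 7\<close> (the numeral type \<open>8\<close> is the
  ring of integers modulo 8, so \<open>0\<close> is a legal index). Coordinate \<open>0\<close> is the real part. The
  multiplication is the bilinear one with unit \<open>e\<^sub>0\<close>, \<open>e\<^sub>i e\<^sub>i = - e\<^sub>0\<close>, and \<open>e\<^sub>i e\<^sub>j = - e\<^sub>j e\<^sub>i = e\<^sub>k\<close>
  whenever \<open>(i, j, k)\<close> is a cyclic rotation of one of the triples \<open>(n, n + 1, n + 3)\<close>, the indices
  being read modulo 7 in \<open>{1, \<dots>, 7}\<close>.
\<close>

type_synonym oct = "real^8"

definition omult :: "oct \<Rightarrow> oct \<Rightarrow> oct"  (infixl \<open>\<odot>\<close> 70) where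
  "x \<odot> y =
      (x$0*y$0 - x$1*y$1 - x$2*y$2 - x$3*y$3 - x$4*y$4 - x$5*y$5 - x$6*y$6 - x$7*y$7) *\<^sub>R axis 0 1
    + (x$0*y$1 + x$1*y$0 + x$2*y$4 - x$4*y$2 + x$3*y$7 - x$7*y$3 + x$5*y$6 - x$6*y$5) *\<^sub>R axis 1 1
    + (x$0*y$2 + x$2*y$0 + x$3*y$5 - x$5*y$3 + x$4*y$1 - x$1*y$4 + x$6*y$7 - x$7*y$6) *\<^sub>R axis 2 1
    + (x$0*y$3 + x$3*y$0 + x$4*y$6 - x$6*y$4 + x$5*y$2 - x$2*y$5 + x$7*y$1 - x$1*y$7) *\<^sub>R axis 3 1
    + (x$0*y$4 + x$4*y$0 + x$5*y$7 - x$7*y$5 + x$6*y$3 - x$3*y$6 + x$1*y$2 - x$2*y$1) *\<^sub>R axis 4 1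
    + (x$0*y$5 + x$5*y$0 + x$6*y$1 - x$1*y$6 + x$7*y$4 - x$4*y$7 + x$2*y$3 - x$3*y$2) *\<^sub>R axis 5 1
    + (x$0*y$6 + x$6*y$0 + x$7*y$2 - x$2*y$7 + x$1*y$5 - x$5*y$1 + x$3*y$4 - x$4*y$3) *\<^sub>R axis 6 1
    + (x$0*y$7 + x$7*y$0 + x$1*y$3 - x$3*y$1 + x$2*y$6 - x$6*y$2 + x$4*y$5 - x$5*y$4) *\<^sub>R axis 7 1"

definition oone :: oct where
  "oone = axis 0 1"

definition oconj :: "oct \<Rightarrow> oct" where
  "oconj x = (\<chi> i. if i = 0 then x$0 else - x$i)"

definition oinverse :: "oct \<Rightarrow> oct" where
  "oinverse x = (1 / (norm x)\<^sup>2) *\<^sub>R oconj x"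

definition S7 :: "oct set" where
  "S7 = sphere 0 1"

text \<open>\<open>T\<^sub>1 S\<^sup>7\<close> is the orthogonal complement of the unit, that is, the purely imaginary octonions.\<close>

definition S6 :: "oct set" where
  "S6 = {u. norm u = 1 \<and> u \<bullet> oone = 0}"

definition open_hemisphere :: "oct \<Rightarrow> oct set" where
  "open_hemisphere v = {u \<in> S6. u \<bullet> v > 0}"

lemma UNIV_8: "(UNIV :: 8 set) = {0, 1, 2, 3, 4, 5, 6, 7}"
proof -
  have "x \<in> {0, 1, 2, 3, 4, 5, 6, 7}" for x :: 8
  proof (induct x)
    case (of_int z)
    then have "z = 0 \<or> z = 1 \<or> z = 2 \<or> z = 3 \<or> z = 4 \<or> z = 5 \<or> z = 6 \<or> z = 7" by fastforce
    then show ?case by auto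
  qed
  then show ?thesis by blast
qed

lemma forall_8: "(\<forall>i::8. P i) \<longleftrightarrow> P 0 \<and> P 1 \<and> P 2 \<and> P 3 \<and> P 4 \<and> P 5 \<and> P 6 \<and> P 7"
proof -
  have "(\<forall>i::8. P i) \<longleftrightarrow> (\<forall>i\<in>{0, 1, 2, 3, 4, 5, 6, 7}. P i)"
    by (simp flip: UNIV_8)
  then show ?thesis by simp
qed

lemma sum_8: "sum g (UNIV :: 8 set) = g 0 + g 1 + g 2 + g 3 + g 4 + g 5 + g 6 + g 7"
  unfolding UNIV_8 by (simp add: ac_simps)

lemma omult_nth:
  "(x \<odot> y)$0 = x$0*y$0 - x$1*y$1 - x$2*y$2 - x$3*y$3 - x$4*y$4 - x$5*y$5 - x$6*y$6 - x$7*y$7"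
  "(x \<odot> y)$1 = x$0*y$1 + x$1*y$0 + x$2*y$4 - x$4*y$2 + x$3*y$7 - x$7*y$3 + x$5*y$6 - x$6*y$5"
  "(x \<odot> y)$2 = x$0*y$2 + x$2*y$0 + x$3*y$5 - x$5*y$3 + x$4*y$1 - x$1*y$4 + x$6*y$7 - x$7*y$6"
  "(x \<odot> y)$3 = x$0*y$3 + x$3*y$0 + x$4*y$6 - x$6*y$4 + x$5*y$2 - x$2*y$5 + x$7*y$1 - x$1*y$7"
  "(x \<odot> y)$4 = x$0*y$4 + x$4*y$0 + x$5*y$7 - x$7*y$5 + x$6*y$3 - x$3*y$6 + x$1*y$2 - x$2*y$1"
  "(x \<odot> y)$5 = x$0*y$5 + x$5*y$0 + x$6*y$1 - x$1*y$6 + x$7*y$4 - x$4*y$7 + x$2*y$3 - x$3*y$2"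
  "(x \<odot> y)$6 = x$0*y$6 + x$6*y$0 + x$7*y$2 - x$2*y$7 + x$1*y$5 - x$5*y$1 + x$3*y$4 - x$4*y$3"
  "(x \<odot> y)$7 = x$0*y$7 + x$7*y$0 + x$1*y$3 - x$3*y$1 + x$2*y$6 - x$6*y$2 + x$4*y$5 - x$5*y$4"
  by (simp_all add: omult_def axis_def)

lemma inner_oct:
  "x \<bullet> y = x$0*y$0 + x$1*y$1 + x$2*y$2 + x$3*y$3 + x$4*y$4 + x$5*y$5 + x$6*y$6 + x$7*y$7"
  for x y :: oct
  by (simp add: inner_vec_def sum_8)

lemma omult_oone [simp]: "x \<odot> oone = x" "oone \<odot> x = x"
  by (simp_all add: vec_eq_iff forall_8 omult_nth oone_def axis_def)

lemma norm_omult: "norm (x \<odot> y) = norm x * norm y"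
proof -
  have "(x \<odot> y) \<bullet> (x \<odot> y) = (x \<bullet> x) * (y \<bullet> y)"
    unfolding inner_oct omult_nth by algebra
  then show ?thesis
    by (simp add: norm_eq_sqrt_inner real_sqrt_mult)
qed

lemma oinverse_omult:
  assumes "x \<noteq> 0"
  shows "oinverse x \<odot> x = oone" "x \<odot> oinverse x = oone"
proof -
  have scale: "(c *\<^sub>R a) \<odot> b = c *\<^sub>R (a \<odot> b)" "a \<odot> (c *\<^sub>R b) = c *\<^sub>R (a \<odot> b)" for c a b
    by (simp_all add: vec_eq_iff forall_8 omult_nth algebra_simps)
  have "oconj x \<odot> x = (x \<bullet> x) *\<^sub>R oone" "x \<odot> oconj x = (x \<bullet> x) *\<^sub>R oone"
    unfolding inner_oct
    by (simp_all add: vec_eq_iff forall_8 omult_nth oone_def oconj_def axis_def)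
  then show "oinverse x \<odot> x = oone" "x \<odot> oinverse x = oone"
    using assms by (simp_all add: oinverse_def scale dot_square_norm)
qed

section \<open>Smooth maps and smooth manifolds\<close>

text \<open>\<open>f\<close> is of class \<open>C\<^sup>k\<close> on \<open>S\<close>; meant for open \<open>S\<close>.\<close>

primrec Ck_on ::
  "nat \<Rightarrow> 'a set \<Rightarrow> ('a::euclidean_space \<Rightarrow> 'b::real_normed_vector) \<Rightarrow> bool" where
  "Ck_on 0 S f \<longleftrightarrow> continuous_on S f"
| "Ck_on (Suc k) S f \<longleftrightarrow>
     (\<forall>x\<in>S. f differentiable (at x)) \<and>
     (\<forall>v. Ck_on k S (\<lambda>x. frechet_derivative f (at x) v))"

definition smooth_on :: "'a::euclidean_space set \<Rightarrow> ('a \<Rightarrow> 'b::real_normed_vector) \<Rightarrow> bool" where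
  "smooth_on S f \<longleftrightarrow> (\<forall>k. Ck_on k S f)"

text \<open>
  An atlas is a set of local parametrizations \<open>(U, \<phi>)\<close>: homeomorphisms \<open>\<phi>\<close> from an open set \<open>U\<close> of
  the model space onto an open set of the manifold (the values of \<open>\<phi>\<close> outside \<open>U\<close> are irrelevant).
  As the sets \<open>U\<close> are open in the whole model space, manifolds have no boundary.
\<close>

type_synonym ('m, 'a) atlas = "('m set \<times> ('m \<Rightarrow> 'a)) set"

definition smooth_manifold :: "'a topology \<Rightarrow> ('m::euclidean_space, 'a) atlas \<Rightarrow> bool" where
  "smooth_manifold M A \<longleftrightarrow>
     Hausdorff_space M \<and> second_countable M \<and>
     (\<forall>(U, \<phi>)\<in>A. open U \<and> openin M (\<phi> ` U) \<and>
        homeomorphic_map (top_of_set U) (subtopology M (\<phi> ` U)) \<phi>) \<and>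
     topspace M = (\<Union>(U, \<phi>)\<in>A. \<phi> ` U) \<and>
     (\<forall>(U, \<phi>)\<in>A. \<forall>(V, \<psi>)\<in>A. smooth_on (U \<inter> \<phi> -` (\<psi> ` V)) (inv_into V \<psi> \<circ> \<phi>))"

section \<open>Hypersurfaces of the 7-sphere\<close>

text \<open>
  A hypersurface is a smooth 6-manifold \<open>M\<close> with an immersion \<open>f\<close> into the 7-sphere. Embedded
  hypersurfaces \<open>M \<subseteq> S\<^sup>7\<close> are the case where \<open>M\<close> has the subspace topology and \<open>f\<close> is the identity.
\<close>

definition hypersurface_S7 ::
  "'a topology \<Rightarrow> (real^6, 'a) atlas \<Rightarrow> ('a \<Rightarrow> oct) \<Rightarrow> bool" where
  "hypersurface_S7 M A f \<longleftrightarrow>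
     smooth_manifold M A \<and>
     f ` topspace M \<subseteq> S7 \<and>
     (\<forall>(U, \<phi>)\<in>A. smooth_on U (f \<circ> \<phi>) \<and>
        (\<forall>u\<in>U. inj (frechet_derivative (f \<circ> \<phi>) (at u))))"

text \<open>
  A smooth unit vector field along \<open>f\<close> that is tangent to the sphere and normal to the hypersurface.
  Such a field exists iff the hypersurface is orientable.
\<close>

definition unit_normal_field ::
  "'a topology \<Rightarrow> (real^6, 'a) atlas \<Rightarrow> ('a \<Rightarrow> oct) \<Rightarrow> ('a \<Rightarrow> oct) \<Rightarrow> bool" where
  "unit_normal_field M A f \<eta> \<longleftrightarrow>
     (\<forall>p\<in>topspace M. norm (\<eta> p) = 1 \<and> \<eta> p \<bullet> f p = 0) \<and>
     (\<forall>(U, \<phi>)\<in>A. smooth_on U (\<eta> \<circ> \<phi>) \<and>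
        (\<forall>u\<in>U. \<forall>w. \<eta> (\<phi> u) \<bullet> frechet_derivative (f \<circ> \<phi>) (at u) w = 0))"

text \<open>
  For a local parametrization \<open>F\<close> of a hypersurface of the sphere with unit normal \<open>N\<close>, the shape
  operator \<open>X \<mapsto> - \<nabla>\<^sub>X N\<close>, transported to the parameter domain by the differential of \<open>F\<close>. The
  Levi-Civita derivative of the sphere agrees here with the Euclidean derivative: the component of
  \<open>dN(w)\<close> along the position vector \<open>F\<close> is \<open>\<langle>dN(w), F\<rangle> = - \<langle>N, dF(w)\<rangle> = 0\<close>. As \<open>dN(w)\<close> is also
  orthogonal to \<open>N\<close>, it lies in the range of \<open>dF\<close>, where \<open>inv\<close> is a true inverse.
\<close>

definition shape_operator ::
  "(real^6 \<Rightarrow> oct) \<Rightarrow> (real^6 \<Rightarrow> oct) \<Rightarrow> real^6 \<Rightarrow> real^6 \<Rightarrow> real^6" where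
  "shape_operator F N u w =
     inv (frechet_derivative F (at u)) (- frechet_derivative N (at u) w)"

definition mean_curvature :: "(real^6 \<Rightarrow> oct) \<Rightarrow> (real^6 \<Rightarrow> oct) \<Rightarrow> real^6 \<Rightarrow> real" where
  "mean_curvature F N u = trace (matrix (shape_operator F N u)) / 6"

text \<open>
  The mean curvature at a point does not depend on the parametrization (a change of parametrization
  conjugates the shape operator), so this says that it is a constant function on \<open>M\<close>.
\<close>

definition constant_mean_curvature ::
  "(real^6, 'a) atlas \<Rightarrow> ('a \<Rightarrow> oct) \<Rightarrow> ('a \<Rightarrow> oct) \<Rightarrow> bool" where
  "constant_mean_curvature A f \<eta> \<longleftrightarrow>
     (\<exists>H. \<forall>(U, \<phi>)\<in>A. \<forall>u\<in>U. mean_curvature (f \<circ> \<phi>) (\<eta> \<circ> \<phi>) u = H)"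

definition octonionic_Gauss_map :: "('a \<Rightarrow> oct) \<Rightarrow> ('a \<Rightarrow> oct) \<Rightarrow> 'a \<Rightarrow> oct" where
  "octonionic_Gauss_map f \<eta> p = oinverse (f p) \<odot> \<eta> p"

lemma octonionic_Gauss_map_in_S6:
  assumes "hypersurface_S7 M A f" "unit_normal_field M A f \<eta>" "p \<in> topspace M"
  shows "octonionic_Gauss_map f \<eta> p \<in> S6"
proof -
  have fp: "norm (f p) = 1"
    using assms unfolding hypersurface_S7_def S7_def by auto
  have \<eta>p: "norm (\<eta> p) = 1" "\<eta> p \<bullet> f p = 0"
    using assms unfolding unit_normal_field_def by auto
  have "norm (oconj (f p)) = norm (f p)"
    by (simp add: norm_eq_sqrt_inner inner_oct oconj_def)
  moreover have "(oconj (f p) \<odot> \<eta> p) \<bullet> oone = \<eta> p \<bullet> f p"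
    by (simp add: inner_oct omult_nth oconj_def oone_def axis_def mult.commute)
  ultimately show ?thesis
    using fp \<eta>p by (simp add: octonionic_Gauss_map_def S6_def oinverse_def norm_omult)
qed

end

theory Submission
  imports Defs
begin

text \<open>
  Let \<open>v\<close> be an imaginary unit octonion. Right multiplication \<open>B x = x \<odot> v\<close> is skew-symmetric, so it
  restricts to a Killing field of the sphere, and \<open>\<langle>\<gamma>, v\<rangle> = \<langle>\<eta>, B f\<rangle>\<close> is the normal component \<open>g\<close> of that
  field along the hypersurface. On a hypersurface of constant mean curvature such a function satisfies
  the Jacobi equation \<open>\<Delta> g = - (|A|\<^sup>2 + 6) g\<close>, where \<open>A\<close> is the second fundamental form. If the Gauss
  image lay in the open hemisphere around \<open>v\<close>, then \<open>g\<close> would be positive, and by compactness it would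
  have a positive minimum. There \<open>\<Delta> g \<ge> 0\<close>, while the right-hand side is negative.

  Only the Jacobi equation at a critical point of \<open>g\<close> is needed, and there the Laplacian is
  \<open>\<Sum> D\<^sup>2g(w\<^sub>e, w\<^sub>e)\<close>, the sum being over vectors \<open>w\<^sub>e\<close> of the parameter domain that the differential of
  the parametrization maps to an orthonormal frame; no connection terms appear. All is therefore
  expressed by first and second Euclidean derivatives of a parametrization \<open>F\<close> and of its normal \<open>N\<close>
  at one point. The lemma \<open>jacobi_identity_at_critical_point\<close> is the resulting linear algebra.
  Constancy of the mean curvature enters through \<open>trace_d2N\<close>, which combines the derivative of the
  Weingarten equation \<open>dN = - dF S\<close>, traced, with the Codazzi equation. The theorem
  \<open>no_positive_minimum\<close> is the local conclusion, for hypersurfaces of spheres of any dimension and any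
  skew-symmetric \<open>B\<close>.
\<close>

section \<open>Second derivatives and differentiable linear systems\<close>

text \<open>
  The mean value theorem, applied in direction \<open>w\<close> to \<open>f (y + t z) - f y\<close>, turns the second difference
  into a difference of values of \<open>f' _ w\<close>; differentiability of \<open>f' _ w\<close> at the single point \<open>x\<close> then
  suffices for the limit.
\<close>

lemma second_difference_tendsto:
  fixes f :: "'a::real_normed_vector \<Rightarrow> real"
  assumes U: "open U" "x \<in> U"
    and f: "\<And>y. y \<in> U \<Longrightarrow> (f has_derivative f' y) (at y)"
    and w: "((\<lambda>y. f' y w) has_derivative A) (at x)"
  shows "((\<lambda>t. (f (x + t *\<^sub>R w + t *\<^sub>R z) - f (x + t *\<^sub>R w) - f (x + t *\<^sub>R z) + f x) / t\<^sup>2)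
    \<longlongrightarrow> A z) (at_right 0)"
proof (rule tendstoI)
  fix e :: real assume "e > 0"
  define K where "K = norm w + norm z + 1"
  have K: "K > 0" "norm w + norm z \<le> K"
    by (auto simp: K_def add_nonneg_pos)
  \<comment> \<open>two linearization errors of size at most \<open>e' t K\<close> have to stay below \<open>e t\<close>\<close>
  define e' where "e' = e / (4 * K)"
  have e': "e' > 0" using \<open>e > 0\<close> K by (simp add: e'_def)
  have lin: "bounded_linear A" using w by (rule has_derivative_bounded_linear)
  obtain d where d: "d > 0"
    "\<And>y. norm (y - x) < d \<Longrightarrow> norm (f' y w - f' x w - A (y - x)) \<le> e' * norm (y - x)"
    using w e' unfolding has_derivative_at_alt by blast
  obtain r where r: "r > 0" "ball x r \<subseteq> U" using U open_contains_ball by blast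
  define \<delta> where "\<delta> = min d r / K"
  have "\<delta> > 0" using d r K by (simp add: \<delta>_def)
  have close: "norm (s *\<^sub>R w + t' *\<^sub>R z) \<le> t * K" "norm (s *\<^sub>R w + t' *\<^sub>R z) < min d r"
    if "0 \<le> s" "s \<le> t" "0 \<le> t'" "t' \<le> t" "t < \<delta>" for s t t'
  proof -
    have "norm (s *\<^sub>R w + t' *\<^sub>R z) \<le> s * norm w + t' * norm z"
      using norm_triangle_ineq[of "s *\<^sub>R w" "t' *\<^sub>R z"] that by simp
    also have "\<dots> \<le> t * norm w + t * norm z"
      using that by (intro add_mono mult_right_mono) auto
    also have "\<dots> \<le> t * K" using that K by (simp flip: distrib_left add: mult_left_mono)
    finally show 1: "norm (s *\<^sub>R w + t' *\<^sub>R z) \<le> t * K" .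
    have "t * K < min d r" using that(5) K by (simp add: \<delta>_def pos_less_divide_eq)
    with 1 show "norm (s *\<^sub>R w + t' *\<^sub>R z) < min d r" by simp
  qed
  have main: "dist ((f (x + t *\<^sub>R w + t *\<^sub>R z) - f (x + t *\<^sub>R w) - f (x + t *\<^sub>R z) + f x) / t\<^sup>2) (A z) < e"
    if t: "0 < t" "t < \<delta>" for t
  proof -
    define k where "k s = f (x + s *\<^sub>R w + t *\<^sub>R z) - f (x + s *\<^sub>R w)" for s
    have inU: "x + s *\<^sub>R w + t' *\<^sub>R z \<in> U" if "0 \<le> s" "s \<le> t" "0 \<le> t'" "t' \<le> t" for s t'
    proof (rule subsetD[OF r(2)])
      have "dist x (x + h) = norm h" for h by (simp add: dist_norm)
      then show "x + s *\<^sub>R w + t' *\<^sub>R z \<in> ball x r"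
        using close(2)[OF that t(2)] by (simp add: add.assoc)
    qed
    have der: "(k has_derivative (\<lambda>h. h * (f' (x + s *\<^sub>R w + t *\<^sub>R z) w - f' (x + s *\<^sub>R w) w))) (at s)"
      if s: "0 \<le> s" "s \<le> t" for s
    proof -
      have "((\<lambda>s. f (x + s *\<^sub>R w + c)) has_derivative (\<lambda>h. f' (x + s *\<^sub>R w + c) (h *\<^sub>R w))) (at s)"
        if "x + s *\<^sub>R w + c \<in> U" for c
        by (rule has_derivative_compose[of "\<lambda>s. x + s *\<^sub>R w + c", OF _ f[OF that]])
          (auto intro!: derivative_eq_intros)
      from this[of "t *\<^sub>R z"] this[of 0]
      have "(k has_derivative (\<lambda>h. f' (x + s *\<^sub>R w + t *\<^sub>R z) (h *\<^sub>R w) - f' (x + s *\<^sub>R w) (h *\<^sub>R w))) (at s)"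
        unfolding k_def using inU[OF s, of t] inU[OF s, of 0] t by (auto intro!: has_derivative_diff)
      moreover have "f' y (h *\<^sub>R w) = h * f' y w" if "y \<in> U" for y h
        using f[OF that, THEN has_derivative_linear] by (simp add: linear_cmul)
      ultimately show ?thesis
        using inU[OF s, of t] inU[OF s, of 0] t by (simp add: algebra_simps)
    qed
    have "(k has_derivative (\<lambda>h. h * (f' (x + s *\<^sub>R w + t *\<^sub>R z) w - f' (x + s *\<^sub>R w) w)))
      (at s within {0..t})" if "0 \<le> s" "s \<le> t" for s
      using der[OF that] by (rule has_derivative_at_withinI)
    from mvt_simple[OF t(1) this] obtain s where s: "0 < s" "s < t"
      and ks: "k t - k 0 = (t - 0) * (f' (x + s *\<^sub>R w + t *\<^sub>R z) w - f' (x + s *\<^sub>R w) w)"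
      by auto
    have lin_approx: "\<bar>f' (x + h) w - f' x w - A h\<bar> \<le> e' * (t * K)"
      if "norm h \<le> t * K" "norm h < min d r" for h
    proof -
      have "\<bar>f' (x + h) w - f' x w - A h\<bar> \<le> e' * norm h"
        using d(2)[of "x + h"] that(2) by simp
      also have "\<dots> \<le> e' * (t * K)" using that(1) e' by (intro mult_left_mono) auto
      finally show ?thesis .
    qed
    have "\<bar>f' (x + s *\<^sub>R w + t *\<^sub>R z) w - f' x w - A (s *\<^sub>R w + t *\<^sub>R z)\<bar> \<le> e' * (t * K)"
      using lin_approx[OF close[of s t t]] s t by (simp add: add.assoc)
    moreover have "\<bar>f' (x + s *\<^sub>R w) w - f' x w - A (s *\<^sub>R w)\<bar> \<le> e' * (t * K)"
      using lin_approx[OF close[of s t 0]] s t by simp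
    moreover have "A (s *\<^sub>R w + t *\<^sub>R z) = A (s *\<^sub>R w) + t * A z"
      using lin by (simp add: bounded_linear.linear linear_add linear_cmul)
    ultimately have "\<bar>(f' (x + s *\<^sub>R w + t *\<^sub>R z) w - f' (x + s *\<^sub>R w) w) - t * A z\<bar> \<le> 2 * (e' * (t * K))"
      by linarith
    also have "\<dots> = t * e / 2" using K by (simp add: e'_def)
    also have "\<dots> < t * e" using t \<open>e > 0\<close> by simp
    finally have "\<bar>(k t - k 0) / t - t * A z\<bar> < t * e" using ks t by simp
    moreover have "(k t - k 0) / t - t * A z = t * ((k t - k 0) / t\<^sup>2 - A z)"
      using t by (simp add: field_simps power2_eq_square)
    ultimately have "\<bar>(k t - k 0) / t\<^sup>2 - A z\<bar> < e"
      using t by (simp add: abs_mult)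
    then show ?thesis by (simp add: k_def dist_real_def algebra_simps)
  qed
  show "\<forall>\<^sub>F t in at_right 0. dist ((f (x + t *\<^sub>R w + t *\<^sub>R z) - f (x + t *\<^sub>R w) - f (x + t *\<^sub>R z) + f x) / t\<^sup>2) (A z) < e"
    unfolding eventually_at_right_field using main \<open>\<delta> > 0\<close> by blast
qed

text \<open>
  Both iterated derivatives are the limit of the same second difference, which is symmetric in the two
  directions. Continuity of the second derivative is not needed.
\<close>

lemma second_derivative_symmetric:
  fixes f :: "'a::real_normed_vector \<Rightarrow> 'b::real_inner"
  assumes U: "open U" "x \<in> U"
    and f: "\<And>y. y \<in> U \<Longrightarrow> (f has_derivative f' y) (at y)"
    and w: "((\<lambda>y. f' y w) has_derivative A) (at x)"
    and z: "((\<lambda>y. f' y z) has_derivative B) (at x)"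
  shows "A z = B w"
proof -
  have "A z \<bullet> c = B w \<bullet> c" for c
  proof -
    let ?d = "\<lambda>w z t. (f (x + t *\<^sub>R w + t *\<^sub>R z) \<bullet> c - f (x + t *\<^sub>R w) \<bullet> c - f (x + t *\<^sub>R z) \<bullet> c + f x \<bullet> c) / t\<^sup>2"
    note df = has_derivative_inner_left
    have lim: "(?d w z \<longlongrightarrow> A z \<bullet> c) (at_right 0)"
      by (rule second_difference_tendsto[OF U df[OF f] df[OF w]])
    have "(?d z w \<longlongrightarrow> B w \<bullet> c) (at_right 0)"
      by (rule second_difference_tendsto[OF U df[OF f] df[OF z]])
    moreover have "?d z w = ?d w z"
      by (rule ext) (simp add: algebra_simps)
    ultimately have "(?d w z \<longlongrightarrow> B w \<bullet> c) (at_right 0)" by simp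
    with lim show ?thesis
      by (rule tendsto_unique[OF trivial_limit_at_right_real])
  qed
  then show ?thesis using vector_eq_rdot by blast
qed

lemma second_derivative_nonneg_at_local_min:
  fixes f :: "'a::real_normed_vector \<Rightarrow> real"
  assumes U: "open U" "x \<in> U"
    and f: "\<And>y. y \<in> U \<Longrightarrow> (f has_derivative f' y) (at y)"
    and w: "((\<lambda>y. f' y w) has_derivative A) (at x)"
    and min: "\<And>y. y \<in> U \<Longrightarrow> f x \<le> f y"
  shows "0 \<le> A w"
proof (rule ccontr)
  assume "\<not> 0 \<le> A w"
  have crit: "f' x = (\<lambda>h. 0)"
    using differential_zero_maxmin[OF U(2,1) f[OF U(2)]] min by blast
  define D where "D t = f' (x + t *\<^sub>R w) w" for t
  have "(D has_derivative (\<lambda>h. A (h *\<^sub>R w))) (at 0)"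
    unfolding D_def by (rule has_derivative_compose[where g = "\<lambda>y. f' y w"])
      (use w in \<open>auto intro!: derivative_eq_intros\<close>)
  moreover have "A (h *\<^sub>R w) = A w * h" for h
    using has_derivative_linear[OF w] by (simp add: linear_cmul)
  ultimately have "DERIV D 0 :> A w"
    by (simp add: has_field_derivative_def)
  then obtain d where d: "d > 0" "\<And>h. 0 < h \<Longrightarrow> h < d \<Longrightarrow> D h < D 0"
    using DERIV_neg_dec_right[of D "A w" 0] \<open>\<not> 0 \<le> A w\<close> by auto
  have D0: "D 0 = 0" by (simp add: D_def crit)
  obtain r where r: "r > 0" "ball x r \<subseteq> U" using U open_contains_ball by blast
  define \<delta> where "\<delta> = r / (norm w + 1)"
  have nw: "norm w + 1 > 0" by (simp add: add_nonneg_pos)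
  have \<delta>: "\<delta> > 0" using r nw by (simp add: \<delta>_def)
  define t where "t = min d \<delta> / 2"
  have t: "0 < t" "t < d" "t < \<delta>" using d \<delta> by (auto simp: t_def)
  have inU: "x + s *\<^sub>R w \<in> U" if "0 \<le> s" "s \<le> t" for s
  proof -
    have "s * norm w \<le> t * (norm w + 1)" using that by (intro mult_mono) auto
    also have "\<dots> < r" using t(3) nw by (simp add: \<delta>_def pos_less_divide_eq)
    finally show ?thesis using that by (intro subsetD[OF r(2)]) (simp add: dist_norm)
  qed
  have der: "((\<lambda>s. f (x + s *\<^sub>R w)) has_derivative (\<lambda>h. f' (x + s *\<^sub>R w) (h *\<^sub>R w))) (at s within {0..t})"
    if "0 \<le> s" "s \<le> t" for s
    by (rule has_derivative_at_withinI, rule has_derivative_compose[of "\<lambda>s. x + s *\<^sub>R w", OF _ f[OF inU[OF that]]])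
      (auto intro!: derivative_eq_intros)
  from mvt_simple[OF t(1) der] obtain s where s: "0 < s" "s < t"
    and eq: "f (x + t *\<^sub>R w) - f (x + 0 *\<^sub>R w) = f' (x + s *\<^sub>R w) ((t - 0) *\<^sub>R w)"
    by auto
  have "f' (x + s *\<^sub>R w) ((t - 0) *\<^sub>R w) = t * D s"
    using f[OF inU, THEN has_derivative_linear, of s] s by (simp add: linear_cmul D_def)
  also have "\<dots> < 0" using d(2)[of s] s t D0 by (simp add: mult_pos_neg)
  finally show False using eq min[OF inU[of t]] t by simp
qed

lemma differentiable_prod:
  fixes f :: "'i \<Rightarrow> 'a::real_normed_vector \<Rightarrow> real"
  assumes "finite I" "\<And>i. i \<in> I \<Longrightarrow> f i differentiable (at x)"
  shows "(\<lambda>u. \<Prod>i\<in>I. f i u) differentiable (at x)"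
  using assms by (induction I rule: finite_induct) (auto intro: differentiable_mult)

lemma differentiable_det:
  fixes P :: "'a::real_normed_vector \<Rightarrow> real^'n^'n"
  assumes "\<And>i j. (\<lambda>u. P u $ i $ j) differentiable (at x)"
  shows "(\<lambda>u. det (P u)) differentiable (at x)"
  unfolding det_def using assms
  by (intro differentiable_sum differentiable_mult differentiable_prod ballI) (auto simp: finite_permutations)

text \<open>
  A solution of a linear system depends differentiably on the system wherever the determinant does not
  vanish, because Cramer's rule expresses it by determinants.
\<close>

lemma differentiable_linear_system:
  fixes P :: "'a::real_normed_vector \<Rightarrow> real^'n^'n" and b y :: "'a \<Rightarrow> real^'n"
  assumes P: "\<And>i j. (\<lambda>u. P u $ i $ j) differentiable (at x)"
    and b: "\<And>i. (\<lambda>u. b u $ i) differentiable (at x)"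
    and det: "det (P x) \<noteq> 0"
    and U: "open U" "x \<in> U"
    and sol: "\<And>u. u \<in> U \<Longrightarrow> P u *v y u = b u"
  shows "(\<lambda>u. y u $ k) differentiable (at x)"
proof -
  define q where "q u = det (\<chi> i j. if j = k then b u $ i else P u $ i $ j) / det (P u)" for u
  have dd: "(\<lambda>u. det (P u)) differentiable (at x)" by (rule differentiable_det[OF P])
  have "(\<lambda>u. det (\<chi> i j. if j = k then b u $ i else P u $ i $ j)) differentiable (at x)"
  proof (rule differentiable_det)
    fix i j
    show "(\<lambda>u. (\<chi> i j. if j = k then b u $ i else P u $ i $ j) $ i $ j) differentiable (at x)"
      by (cases "j = k") (simp_all add: P b)
  qed
  then have diff_q: "q differentiable (at x)"
    unfolding q_def by (rule differentiable_divide[OF _ dd det])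
  have "\<forall>\<^sub>F u in nhds x. q u = y u $ k"
  proof -
    have "isCont (\<lambda>u. det (P u)) x" by (rule differentiable_imp_continuous_within[OF dd])
    then have "((\<lambda>u. det (P u)) \<longlongrightarrow> det (P x)) (nhds x)"
      by (simp add: isCont_def tendsto_nhds_iff)
    then have "\<forall>\<^sub>F u in nhds x. det (P u) \<noteq> 0"
      using det by (rule tendsto_imp_eventually_ne)
    moreover have "\<forall>\<^sub>F u in nhds x. u \<in> U" using U by (rule eventually_nhds_in_open)
    ultimately show ?thesis
    proof eventually_elim
      case (elim u)
      from cramer[OF elim(1), THEN iffD1, OF sol[OF elim(2)]]
      show ?case by (simp add: q_def vec_eq_iff)
    qed
  qed
  then obtain T where T: "open T" "x \<in> T" "\<And>u. u \<in> T \<Longrightarrow> q u = y u $ k"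
    unfolding eventually_nhds by blast
  from diff_q obtain q' where "(q has_derivative q') (at x)"
    unfolding differentiable_def by blast
  then have "((\<lambda>u. y u $ k) has_derivative q') (at x)"
    by (rule has_derivative_transform_within_open[OF _ T])
  then show ?thesis unfolding differentiable_def by blast
qed

section \<open>The Jacobi equation in an orthonormal frame\<close>

text \<open>
  The trace of an endomorphism \<open>R\<close> of the parameter space, computed in a frame \<open>E\<close> of the range of the
  embedding \<open>D\<close>; the vectors \<open>w e\<close> are the preimages of the frame.
\<close>

lemma trace_eq_sum_frame:
  fixes D :: "real^'n \<Rightarrow> 'b::euclidean_space" and w :: "'b \<Rightarrow> real^'n"
  assumes D: "linear D" "inj D"
    and w: "\<And>e. e \<in> E \<Longrightarrow> D (w e) = e"
    and expand: "\<And>x. D x = (\<Sum>e\<in>E. (D x \<bullet> e) *\<^sub>R e)"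
  shows "trace R = (\<Sum>e\<in>E. D (R *v w e) \<bullet> e)"
proof -
  have x: "x = (\<Sum>e\<in>E. (D x \<bullet> e) *\<^sub>R w e)" for x
  proof -
    have "D x = D (\<Sum>e\<in>E. (D x \<bullet> e) *\<^sub>R w e)"
      by (subst expand) (simp add: linear_sum[OF D(1)] linear_cmul[OF D(1)] w)
    with D(2) show ?thesis by (rule injD)
  qed
  have "trace R = (\<Sum>k\<in>UNIV. (R *v axis k 1) $ k)"
    by (simp add: trace_def matrix_vector_mul_component inner_axis)
  also have "\<dots> = (\<Sum>k\<in>UNIV. \<Sum>e\<in>E. (D (R *v axis k 1) \<bullet> e) * w e $ k)"
    by (subst x) simp
  also have "\<dots> = (\<Sum>e\<in>E. \<Sum>k\<in>UNIV. (D (R *v axis k 1) \<bullet> e) * w e $ k)"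
    by (rule sum.swap)
  also have "\<dots> = (\<Sum>e\<in>E. D (R *v w e) \<bullet> e)"
  proof (rule sum.cong[OF refl])
    fix e
    have "R *v w e = (\<Sum>k\<in>UNIV. (w e $ k) *\<^sub>R (R *v axis k 1))"
      by (subst basis_expansion[symmetric, of "w e"])
        (simp add: matrix_vector_mult_scaleR[symmetric] linear_sum scalar_mult_eq_scaleR)
    then show "(\<Sum>k\<in>UNIV. (D (R *v axis k 1) \<bullet> e) * w e $ k) = D (R *v w e) \<bullet> e"
      by (simp add: linear_sum[OF D(1)] linear_cmul[OF D(1)] inner_sum_left mult.commute)
  qed
  finally show ?thesis .
qed

text \<open>
  The Jacobi equation at a critical point of \<open>g = \<langle>n, B p\<rangle>\<close>. Here \<open>p\<close> is the point of the sphere, \<open>n\<close> the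
  normal and \<open>E\<close> an orthonormal tangent frame; \<open>dn e\<close>, \<open>nn e\<close> and \<open>ff e\<close> stand for the first and second
  derivatives of the normal and the second derivative of the position in the direction \<open>e\<close>. The left-hand
  side is the sum of the second derivatives of \<open>g\<close>. Apart from \<open>crit\<close>, which says that \<open>g\<close> is critical,
  and \<open>nnf\<close>, the hypotheses on the derivatives come from differentiating the relations between \<open>p\<close>, \<open>n\<close>
  and the tangent space.
\<close>

lemma jacobi_identity_at_critical_point:
  fixes E :: "'b::real_inner set" and n p :: 'b and B dn nn ff :: "'b \<Rightarrow> 'b"
  assumes B: "\<And>x y. B x \<bullet> y = - (x \<bullet> B y)"
    and unit: "n \<bullet> n = 1" "p \<bullet> p = 1" "n \<bullet> p = 0"
    and E: "\<And>e. e \<in> E \<Longrightarrow> e \<bullet> e = 1"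
    and expand: "\<And>x. x = (x \<bullet> p) *\<^sub>R p + (x \<bullet> n) *\<^sub>R n + (\<Sum>e\<in>E. (x \<bullet> e) *\<^sub>R e)"
    and dn: "\<And>e. e \<in> E \<Longrightarrow> dn e \<bullet> p = 0" "\<And>e. e \<in> E \<Longrightarrow> dn e \<bullet> n = 0"
    and h: "\<And>e f. e \<in> E \<Longrightarrow> f \<in> E \<Longrightarrow> dn e \<bullet> f = dn f \<bullet> e"
    and H: "\<And>e. e \<in> E \<Longrightarrow> n \<bullet> ff e = - (dn e \<bullet> e)"
    and ffp: "\<And>e. e \<in> E \<Longrightarrow> ff e \<bullet> p = - (e \<bullet> e)"
    and nnp: "\<And>e. e \<in> E \<Longrightarrow> nn e \<bullet> p = - (dn e \<bullet> e)"
    and nnn: "\<And>e. e \<in> E \<Longrightarrow> nn e \<bullet> n = - (dn e \<bullet> dn e)"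
    and nnf: "\<And>f. f \<in> E \<Longrightarrow> (\<Sum>e\<in>E. nn e \<bullet> f) = (\<Sum>e\<in>E. dn f \<bullet> ff e)"
    and crit: "\<And>e. e \<in> E \<Longrightarrow> dn e \<bullet> B p + n \<bullet> B e = 0"
  shows "(\<Sum>e\<in>E. nn e \<bullet> B p + 2 * (dn e \<bullet> B e) + n \<bullet> B (ff e))
    = - ((\<Sum>e\<in>E. dn e \<bullet> dn e) + card E) * (n \<bullet> B p)"
proof -
  define Z where "Z = (\<Sum>e\<in>E. ff e)"
  have inner_expand: "x \<bullet> y = (x \<bullet> p) * (y \<bullet> p) + (x \<bullet> n) * (y \<bullet> n) + (\<Sum>e\<in>E. (x \<bullet> e) * (y \<bullet> e))" for x y
    by (subst expand[of y]) (simp add: inner_add_right inner_sum_right mult.commute)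
  have B0: "B x \<bullet> x = 0" "x \<bullet> B x = 0" for x
    using B[of x x] by (simp_all add: inner_commute)
  \<comment> \<open>the shape operator moves to the other factor by symmetry, and criticality replaces \<open>\<langle>dn f, B p\<rangle>\<close>\<close>
  have tangent: "(\<Sum>e\<in>E. (B p \<bullet> e) * (dn e \<bullet> y)) = (\<Sum>e\<in>E. (B n \<bullet> e) * (e \<bullet> y))" for y
  proof -
    have "(\<Sum>e\<in>E. (B p \<bullet> e) * (dn e \<bullet> y)) = (\<Sum>e\<in>E. \<Sum>f\<in>E. (B p \<bullet> e) * ((dn e \<bullet> f) * (y \<bullet> f)))"
      by (rule sum.cong[OF refl], subst inner_expand) (simp add: dn sum_distrib_left)
    also have "\<dots> = (\<Sum>e\<in>E. \<Sum>f\<in>E. (B p \<bullet> e) * ((dn f \<bullet> e) * (y \<bullet> f)))"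
      using h by (intro sum.cong refl) simp
    also have "\<dots> = (\<Sum>f\<in>E. \<Sum>e\<in>E. (B p \<bullet> e) * ((dn f \<bullet> e) * (y \<bullet> f)))"
      by (rule sum.swap)
    also have "\<dots> = (\<Sum>f\<in>E. (dn f \<bullet> B p) * (f \<bullet> y))"
    proof (rule sum.cong[OF refl])
      fix f assume "f \<in> E"
      then have "dn f \<bullet> B p = (\<Sum>e\<in>E. (dn f \<bullet> e) * (B p \<bullet> e))"
        by (subst inner_expand) (simp add: dn)
      then show "(\<Sum>e\<in>E. (B p \<bullet> e) * ((dn f \<bullet> e) * (y \<bullet> f))) = (dn f \<bullet> B p) * (f \<bullet> y)"
        by (simp add: sum_distrib_left inner_commute[of y] mult_ac)
    qed
    also have "\<dots> = (\<Sum>f\<in>E. (B n \<bullet> f) * (f \<bullet> y))"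
    proof (rule sum.cong[OF refl])
      fix f assume "f \<in> E"
      then have "dn f \<bullet> B p = B n \<bullet> f" using crit[of f] B[of n f] by simp
      then show "(dn f \<bullet> B p) * (f \<bullet> y) = (B n \<bullet> f) * (f \<bullet> y)" by simp
    qed
    finally show ?thesis .
  qed
  have "(\<Sum>e\<in>E. nn e \<bullet> B p)
      = (\<Sum>e\<in>E. (nn e \<bullet> n) * (B p \<bullet> n) + (\<Sum>f\<in>E. (nn e \<bullet> f) * (B p \<bullet> f)))"
    by (rule sum.cong[OF refl], subst inner_expand) (simp add: B0)
  also have "\<dots> = - (\<Sum>e\<in>E. dn e \<bullet> dn e) * (B p \<bullet> n) + (\<Sum>e\<in>E. \<Sum>f\<in>E. (nn e \<bullet> f) * (B p \<bullet> f))"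
    by (simp add: sum.distrib sum_subtractf nnn sum_distrib_right sum_negf)
  also have "(\<Sum>e\<in>E. \<Sum>f\<in>E. (nn e \<bullet> f) * (B p \<bullet> f)) = (\<Sum>f\<in>E. (\<Sum>e\<in>E. nn e \<bullet> f) * (B p \<bullet> f))"
    by (subst sum.swap) (simp add: sum_distrib_right)
  also have "\<dots> = (\<Sum>f\<in>E. (B p \<bullet> f) * (dn f \<bullet> Z))"
    by (rule sum.cong[OF refl]) (simp add: nnf Z_def inner_sum_right)
  also have "\<dots> = (\<Sum>e\<in>E. (B n \<bullet> e) * (e \<bullet> Z))" by (rule tangent)
  finally have 1: "(\<Sum>e\<in>E. nn e \<bullet> B p)
      = - (\<Sum>e\<in>E. dn e \<bullet> dn e) * (B p \<bullet> n) + (\<Sum>e\<in>E. (B n \<bullet> e) * (e \<bullet> Z))" .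
  \<comment> \<open>contraction of the symmetric \<open>\<langle>dn e, f\<rangle>\<close> with the skew-symmetric \<open>\<langle>B e, f\<rangle>\<close>\<close>
  have 2: "(\<Sum>e\<in>E. dn e \<bullet> B e) = 0"
  proof -
    have *: "(\<Sum>e\<in>E. dn e \<bullet> B e) = (\<Sum>e\<in>E. \<Sum>f\<in>E. (dn e \<bullet> f) * (B e \<bullet> f))"
      by (rule sum.cong[OF refl], subst inner_expand) (simp add: dn)
    also have "\<dots> = (\<Sum>e\<in>E. \<Sum>f\<in>E. - ((dn f \<bullet> e) * (B f \<bullet> e)))"
    proof (intro sum.cong refl)
      fix e f assume "e \<in> E" "f \<in> E"
      then show "(dn e \<bullet> f) * (B e \<bullet> f) = - ((dn f \<bullet> e) * (B f \<bullet> e))"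
        using h[of e f] B[of e f] by (simp add: inner_commute[of e])
    qed
    also have "\<dots> = - (\<Sum>e\<in>E. \<Sum>f\<in>E. (dn e \<bullet> f) * (B e \<bullet> f))"
      by (subst sum.swap) (simp add: sum_negf)
    finally show ?thesis using * by simp
  qed
  have "(\<Sum>e\<in>E. n \<bullet> B (ff e)) = - (B n \<bullet> Z)"
    unfolding Z_def inner_sum_right sum_negf[symmetric] using B[of n] by simp
  also have "B n \<bullet> Z = (B n \<bullet> p) * (Z \<bullet> p) + (\<Sum>e\<in>E. (B n \<bullet> e) * (e \<bullet> Z))"
    by (subst inner_expand) (simp add: B0 inner_commute)
  also have "Z \<bullet> p = - card E"
    by (simp add: Z_def inner_sum_left ffp E sum_negf)
  finally have 3: "(\<Sum>e\<in>E. n \<bullet> B (ff e)) = card E * (B n \<bullet> p) - (\<Sum>e\<in>E. (B n \<bullet> e) * (e \<bullet> Z))"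
    by simp
  have 4: "B n \<bullet> p = - (n \<bullet> B p)" by (rule B)
  show ?thesis
    unfolding sum.distrib sum_distrib_left[symmetric] 1 2 3 4 inner_commute[of "B p" n]
    by (simp add: algebra_simps)
qed

section \<open>Hypersurface patches in a sphere\<close>

lemma linear_axis_expansion:
  fixes f :: "real^'n \<Rightarrow> 'b::real_vector"
  assumes "linear f"
  shows "f x = (\<Sum>j\<in>UNIV. x $ j *\<^sub>R f (axis j 1))"
proof -
  have "f x = f (\<Sum>j\<in>UNIV. x $ j *\<^sub>R axis j 1)"
    using basis_expansion[of x] by (simp add: scalar_mult_eq_scaleR)
  then show ?thesis by (simp add: linear_sum[OF assms] linear_cmul[OF assms])
qed

lemma derivative_of_constant_on_open:
  fixes f :: "'a::real_normed_vector \<Rightarrow> 'b::real_normed_vector"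
  assumes "(f has_derivative f') (at x)" "open U" "x \<in> U" "\<And>u. u \<in> U \<Longrightarrow> f u = c"
  shows "f' = (\<lambda>h. 0)"
proof -
  have "((\<lambda>u. c) has_derivative f') (at x)"
    by (rule has_derivative_transform_within_open[OF assms(1-3)]) (rule assms(4))
  then show ?thesis by (rule has_derivative_unique[OF _ has_derivative_const])
qed

text \<open>
  A parametrized piece \<open>F\<close> of an immersed hypersurface of a unit sphere with unit normal \<open>N\<close>. The
  sphere has dimension one less than the ambient space, hence the codimension two in \<open>dim\<close>. Two
  derivatives are required, without continuity of the second.
\<close>

locale sphere_hypersurface_patch =
  fixes U :: "(real^'n) set" and F N :: "real^'n \<Rightarrow> 'b::euclidean_space"
  assumes dim: "DIM('b) = CARD('n) + 2"
    and U: "open U"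
    and F1: "u \<in> U \<Longrightarrow> F differentiable (at u)"
    and F2: "u \<in> U \<Longrightarrow> (\<lambda>u. frechet_derivative F (at u) w) differentiable (at u)"
    and N1: "u \<in> U \<Longrightarrow> N differentiable (at u)"
    and N2: "u \<in> U \<Longrightarrow> (\<lambda>u. frechet_derivative N (at u) w) differentiable (at u)"
    and inj_dF: "u \<in> U \<Longrightarrow> inj (frechet_derivative F (at u))"
    and FF: "u \<in> U \<Longrightarrow> F u \<bullet> F u = 1"
    and NN: "u \<in> U \<Longrightarrow> N u \<bullet> N u = 1"
    and NF: "u \<in> U \<Longrightarrow> N u \<bullet> F u = 0"
    and NdF: "u \<in> U \<Longrightarrow> N u \<bullet> frechet_derivative F (at u) w = 0"
begin

text \<open>
  In \<open>d2F u w z\<close> and \<open>d2N u w z\<close> the first derivative is in the direction \<open>w\<close>, the second in the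
  direction \<open>z\<close>.
\<close>

definition dF :: "real^'n \<Rightarrow> real^'n \<Rightarrow> 'b" where "dF u = frechet_derivative F (at u)"
definition dN :: "real^'n \<Rightarrow> real^'n \<Rightarrow> 'b" where "dN u = frechet_derivative N (at u)"
definition d2F :: "real^'n \<Rightarrow> real^'n \<Rightarrow> real^'n \<Rightarrow> 'b" where
  "d2F u w = frechet_derivative (\<lambda>y. dF y w) (at u)"
definition d2N :: "real^'n \<Rightarrow> real^'n \<Rightarrow> real^'n \<Rightarrow> 'b" where
  "d2N u w = frechet_derivative (\<lambda>y. dN y w) (at u)"

context
  fixes u assumes u: "u \<in> U"
begin

lemma deriv:
  "(F has_derivative dF u) (at u)"
  "(N has_derivative dN u) (at u)"
  "((\<lambda>y. dF y w) has_derivative d2F u w) (at u)"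
  "((\<lambda>y. dN y w) has_derivative d2N u w) (at u)"
  using F1[OF u] N1[OF u] F2[OF u] N2[OF u]
  by (simp_all add: dF_def dN_def d2F_def d2N_def frechet_derivative_works)

lemma linear_deriv:
  "linear (dF u)" "linear (dN u)" "linear (d2F u w)" "linear (d2N u w)"
  by (fact deriv[THEN has_derivative_linear])+

lemma inj_dF': "inj (dF u)"
  unfolding dF_def by (rule inj_dF[OF u])

lemma dF_F: "dF u w \<bullet> F u = 0"
proof -
  have "((\<lambda>y. F y \<bullet> F y) has_derivative (\<lambda>h. F u \<bullet> dF u h + dF u h \<bullet> F u)) (at u)"
    by (intro has_derivative_inner deriv)
  from derivative_of_constant_on_open[OF this U u FF] show ?thesis
    by (simp add: fun_eq_iff inner_commute)
qed

lemma dN_N: "dN u w \<bullet> N u = 0"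
proof -
  have "((\<lambda>y. N y \<bullet> N y) has_derivative (\<lambda>h. N u \<bullet> dN u h + dN u h \<bullet> N u)) (at u)"
    by (intro has_derivative_inner deriv)
  from derivative_of_constant_on_open[OF this U u NN] show ?thesis
    by (simp add: fun_eq_iff inner_commute)
qed

lemma N_dF: "N u \<bullet> dF u w = 0"
  using NdF[OF u] by (simp add: dF_def)

lemma dF_N: "dF u w \<bullet> N u = 0"
  using N_dF by (simp add: inner_commute)

lemma dN_F: "dN u w \<bullet> F u = 0"
proof -
  have "((\<lambda>y. N y \<bullet> F y) has_derivative (\<lambda>h. N u \<bullet> dF u h + dN u h \<bullet> F u)) (at u)"
    by (intro has_derivative_inner deriv)
  from derivative_of_constant_on_open[OF this U u NF] show ?thesis
    by (simp add: fun_eq_iff N_dF)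
qed

end

context
  fixes u assumes u: "u \<in> U"
begin

lemma d2F_F: "d2F u w z \<bullet> F u = - (dF u w \<bullet> dF u z)"
proof -
  have "((\<lambda>y. dF y w \<bullet> F y) has_derivative (\<lambda>h. dF u w \<bullet> dF u h + d2F u w h \<bullet> F u)) (at u)"
    by (intro has_derivative_inner deriv u)
  from derivative_of_constant_on_open[OF this U u dF_F] show ?thesis
    by (simp add: fun_eq_iff add_eq_0_iff)
qed

lemma d2F_N: "N u \<bullet> d2F u w z = - (dN u z \<bullet> dF u w)"
proof -
  have "((\<lambda>y. N y \<bullet> dF y w) has_derivative (\<lambda>h. N u \<bullet> d2F u w h + dN u h \<bullet> dF u w)) (at u)"
    by (intro has_derivative_inner deriv u)
  from derivative_of_constant_on_open[OF this U u N_dF] show ?thesis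
    by (simp add: fun_eq_iff add_eq_0_iff2)
qed

lemma d2N_F: "d2N u w z \<bullet> F u = - (dN u w \<bullet> dF u z)"
proof -
  have "((\<lambda>y. dN y w \<bullet> F y) has_derivative (\<lambda>h. dN u w \<bullet> dF u h + d2N u w h \<bullet> F u)) (at u)"
    by (intro has_derivative_inner deriv u)
  from derivative_of_constant_on_open[OF this U u dN_F] show ?thesis
    by (simp add: fun_eq_iff add_eq_0_iff)
qed

lemma d2N_N: "d2N u w z \<bullet> N u = - (dN u w \<bullet> dN u z)"
proof -
  have "((\<lambda>y. dN y w \<bullet> N y) has_derivative (\<lambda>h. dN u w \<bullet> dN u h + d2N u w h \<bullet> N u)) (at u)"
    by (intro has_derivative_inner deriv u)
  from derivative_of_constant_on_open[OF this U u dN_N] show ?thesis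
    by (simp add: fun_eq_iff add_eq_0_iff)
qed

lemma d2F_sym: "d2F u w z = d2F u z w"
  by (rule second_derivative_symmetric[where f = F and f' = dF and w = w and z = z,
    OF U u deriv(1) deriv(3)[OF u] deriv(3)[OF u]])

lemma d2N_sym: "d2N u w z = d2N u z w"
  by (rule second_derivative_symmetric[where f = N and f' = dN and w = w and z = z,
    OF U u deriv(2) deriv(4)[OF u] deriv(4)[OF u]])

lemma second_fundamental_form_sym: "dN u z \<bullet> dF u w = dN u w \<bullet> dF u z"
  using d2F_N[of w z] d2F_N[of z w] d2F_sym[of w z] by simp

end

text \<open>
  The Codazzi equation, in the form of the differentiated symmetry of the second fundamental form.
\<close>

lemma codazzi:
  assumes u: "u \<in> U"
  shows "d2N u z y \<bullet> dF u w + dN u z \<bullet> d2F u w y = d2N u w y \<bullet> dF u z + dN u w \<bullet> d2F u z y"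
proof -
  have "((\<lambda>y. dN y z \<bullet> dF y w - dN y w \<bullet> dF y z) has_derivative
    (\<lambda>h. (dN u z \<bullet> d2F u w h + d2N u z h \<bullet> dF u w) - (dN u w \<bullet> d2F u z h + d2N u w h \<bullet> dF u z))) (at u)"
    by (intro has_derivative_inner has_derivative_diff deriv u)
  moreover have "dN y z \<bullet> dF y w - dN y w \<bullet> dF y z = 0" if "y \<in> U" for y
    using second_fundamental_form_sym[OF that, of z w] by simp
  ultimately have "(\<lambda>h. (dN u z \<bullet> d2F u w h + d2N u z h \<bullet> dF u w) - (dN u w \<bullet> d2F u z h + d2N u w h \<bullet> dF u z)) = (\<lambda>h. 0)"
    by (rule derivative_of_constant_on_open[OF _ U u])
  from fun_cong[OF this, of y] show ?thesis by simp
qed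

text \<open>
  Orthonormal tangent frames at \<open>u\<close>. Orthogonality is expressed by the last clause: together with the
  position and the normal, the frame expands every vector of the ambient space.
\<close>

definition tangent_frame :: "real^'n \<Rightarrow> 'b set \<Rightarrow> bool" where
  "tangent_frame u E \<longleftrightarrow> finite E \<and> card E = CARD('n) \<and> E \<subseteq> range (dF u) \<and> (\<forall>e\<in>E. e \<bullet> e = 1) \<and>
    (\<forall>x. (x \<bullet> F u) *\<^sub>R F u + (x \<bullet> N u) *\<^sub>R N u + (\<Sum>e\<in>E. (x \<bullet> e) *\<^sub>R e) = x)"

lemma tangent_frameD:
  assumes "tangent_frame u E"
  shows "finite E" "card E = CARD('n)" "e \<in> E \<Longrightarrow> e \<in> range (dF u)" "e \<in> E \<Longrightarrow> e \<bullet> e = 1"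
    "(x \<bullet> F u) *\<^sub>R F u + (x \<bullet> N u) *\<^sub>R N u + (\<Sum>e\<in>E. (x \<bullet> e) *\<^sub>R e) = x"
  using assms unfolding tangent_frame_def by auto

lemma tangent_frame_exists:
  assumes u: "u \<in> U"
  shows "\<exists>E. tangent_frame u E"
proof -
  have lin: "linear (dF u)" and inj: "inj (dF u)"
    using linear_deriv(1)[OF u] inj_dF'[OF u] by blast+
  have sub: "subspace (range (dF u))" by (rule linear_subspace_image[OF lin subspace_UNIV])
  obtain E where E: "E \<subseteq> range (dF u)" "pairwise orthogonal E" "\<And>x. x \<in> E \<Longrightarrow> norm x = 1"
    "independent E" "card E = dim (range (dF u))" "span E = range (dF u)"
    using orthonormal_basis_subspace[OF sub] by blast
  have card: "card E = CARD('n)"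
    using E(5) dim_image_eq[OF lin, of UNIV] inj by simp
  have fin: "finite E" using E(4) by (rule independent_imp_finite)
  define E' where "E' = insert (F u) (insert (N u) E)"
  have orthF: "F u \<bullet> e = 0" "e \<bullet> F u = 0" if "e \<in> E" for e
  proof -
    show "e \<bullet> F u = 0" using that E(1) dF_F[OF u] by blast
    then show "F u \<bullet> e = 0" by (simp add: inner_commute)
  qed
  have orthN: "N u \<bullet> e = 0" "e \<bullet> N u = 0" if "e \<in> E" for e
  proof -
    show "e \<bullet> N u = 0" using that E(1) dF_N[OF u] by blast
    then show "N u \<bullet> e = 0" by (simp add: inner_commute)
  qed
  have notin: "F u \<notin> E" "N u \<notin> E" "F u \<noteq> N u"
    using orthF(1)[of "F u"] orthN(1)[of "N u"] FF[OF u] NN[OF u] NF[OF u] by auto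
  have orth: "pairwise orthogonal E'"
    using E(2) orthF orthN NF[OF u] unfolding E'_def pairwise_insert orthogonal_def
    by (auto simp: inner_commute)
  have unit: "norm x = 1" if "x \<in> E'" for x
    using that E(3) FF[OF u] NN[OF u] by (auto simp: E'_def norm_eq_1)
  have ind: "independent E'"
    using orth unit[of 0] by (intro pairwise_orthogonal_independent) auto
  have "card E' = DIM('b)" using notin card dim fin by (simp add: E'_def)
  then have "span E' = UNIV" using ind
    using card_ge_dim_independent[of E' UNIV] by (simp add: top.extremum_unique)
  then have ex: "(\<Sum>e\<in>E'. (x \<bullet> e) *\<^sub>R e) = x" for x
    using orthonormal_basis_expand[OF orth unit, of x] fin by (simp add: E'_def)
  have sum_E': "(x \<bullet> F u) *\<^sub>R F u + (x \<bullet> N u) *\<^sub>R N u + (\<Sum>e\<in>E. (x \<bullet> e) *\<^sub>R e) = x" for x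
    using ex[of x] notin fin by (simp add: E'_def add.assoc)
  have unit_E: "e \<bullet> e = 1" if "e \<in> E" for e
    using E(3)[OF that] by (simp add: norm_eq_1)
  show ?thesis
    unfolding tangent_frame_def by (intro exI[of _ E] conjI ballI allI fin card E(1) unit_E sum_E')
qed

lemma dF_frame_expand:
  assumes u: "u \<in> U" and E: "tangent_frame u E"
  shows "dF u x = (\<Sum>e\<in>E. (dF u x \<bullet> e) *\<^sub>R e)"
  by (subst tangent_frameD(5)[OF E, symmetric]) (simp add: dF_F[OF u] dF_N[OF u])

lemma dN_frame_expand:
  assumes u: "u \<in> U" and E: "tangent_frame u E"
  shows "dN u x = (\<Sum>e\<in>E. (dN u x \<bullet> e) *\<^sub>R e)"
  by (subst tangent_frameD(5)[OF E, symmetric]) (simp add: dN_F[OF u] dN_N[OF u])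

text \<open>
  The derivative of the normal is tangent, so the shape operator is defined by a true inverse.
\<close>

lemma dN_in_range:
  assumes u: "u \<in> U"
  shows "dN u w \<in> range (dF u)"
proof -
  obtain E where E: "tangent_frame u E" using tangent_frame_exists[OF u] by blast
  have "(\<Sum>e\<in>E. (dN u w \<bullet> e) *\<^sub>R e) \<in> range (dF u)"
    using linear_subspace_image[OF linear_deriv(1)[OF u] subspace_UNIV] tangent_frameD(3)[OF E]
    by (intro subspace_sum subspace_scale) auto
  then show ?thesis by (subst dN_frame_expand[OF u E])
qed

text \<open>
  The matrix of the shape operator on the parameter space.
\<close>

definition shape :: "real^'n \<Rightarrow> real^'n^'n" where
  "shape u = matrix (\<lambda>w. inv (dF u) (- dN u w))"

lemma dF_shape:
  assumes u: "u \<in> U"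
  shows "dF u (shape u *v w) = - dN u w"
proof -
  note lin = linear_deriv[OF u]
  have inj: "inj (dF u)" using u by (rule inj_dF')
  define S where "S w = inv (dF u) (- dN u w)" for w
  have S: "dF u (S w) = - dN u w" for w
  proof -
    obtain y where "dN u w = dF u y" using dN_in_range[OF u, of w] by blast
    then have "- dN u w = dF u (- y)" by (simp add: linear_neg lin)
    then show ?thesis unfolding S_def by (metis f_inv_into_f rangeI)
  qed
  have "linear S"
  proof (rule linearI)
    show "S (x + y) = S x + S y" for x y
      by (rule injD[OF inj]) (simp add: S linear_add lin)
    show "S (c *\<^sub>R x) = c *\<^sub>R S x" for c x
      by (rule injD[OF inj]) (simp add: S linear_cmul lin)
  qed
  then have "shape u *v w = S w"
    unfolding shape_def S_def[symmetric] by (metis matrix_vector_mul)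
  then show ?thesis by (simp add: S)
qed

text \<open>
  With a fixed left inverse \<open>L\<close> of \<open>dF u\<close>, the columns of the shape operator at nearby points \<open>y\<close> solve a
  linear system with matrix \<open>L dF y\<close>, which is the identity at \<open>y = u\<close>.
\<close>

lemma shape_differentiable:
  assumes u: "u \<in> U"
  shows "(\<lambda>y. shape y $ i $ k) differentiable (at u)"
proof -
  have lin: "linear (dF u)" and inj: "inj (dF u)"
    using linear_deriv(1)[OF u] inj_dF'[OF u] by blast+
  obtain L where L: "linear L" "L \<circ> dF u = id"
    using linear_injective_left_inverse[OF lin inj] by blast
  have bl: "bounded_linear (\<lambda>x. L x $ i)" for i
    using L(1) by (intro bounded_linear_compose[OF bounded_linear_vec_nth] linear_linear[THEN iffD2])
  define P where "P y = matrix (\<lambda>w. L (dF y w))" for y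
  define b where "b y = L (- dN y (axis k 1))" for y
  have P: "P y *v w = L (dF y w)" if "y \<in> U" for y w
  proof -
    have "linear (\<lambda>w. L (dF y w))"
      using linear_compose[OF linear_deriv(1)[OF that] L(1)] by (simp add: o_def)
    then show ?thesis unfolding P_def by (metis matrix_vector_mul)
  qed
  have "P u = mat 1"
    using L(2) by (simp add: P_def fun_eq_iff matrix_id_mat_1[unfolded id_def])
  then have det: "det (P u) \<noteq> 0" by simp
  have "(\<lambda>y. (shape y *v axis k 1) $ i) differentiable (at u)"
  proof (rule differentiable_linear_system[where P = P and b = b, OF _ _ det U u])
    show "(\<lambda>y. P y $ i $ j) differentiable at u" for i j
      unfolding P_def matrix_def
      using bounded_linear.has_derivative[OF bl deriv(3)[OF u]] by (auto simp: differentiable_def)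
    show "(\<lambda>y. b y $ i) differentiable at u" for i
      unfolding b_def
      using bounded_linear.has_derivative[OF bl has_derivative_minus[OF deriv(4)[OF u]]]
      by (auto simp: differentiable_def)
    show "P y *v (shape y *v axis k 1) = b y" if "y \<in> U" for y
      by (simp add: P that dF_shape b_def)
  qed
  then show ?thesis by (simp add: matrix_vector_mul_component inner_axis)
qed

text \<open>
  The derivative in the direction \<open>z\<close> of the Weingarten equation \<open>dN w = - dF (S w)\<close>; the matrix \<open>T\<close> is the
  derivative of the shape operator \<open>S\<close>.
\<close>

lemma d2N_via_shape:
  assumes u: "u \<in> U"
  shows "\<exists>T. trace T = frechet_derivative (\<lambda>y. trace (shape y)) (at u) z \<and>
    (\<forall>w. d2N u w z = - dF u (T *v w) - d2F u z (shape u *v w))"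
proof -
  define T' where "T' i k = frechet_derivative (\<lambda>y. shape y $ i $ k) (at u)" for i k
  have T': "((\<lambda>y. shape y $ i $ k) has_derivative T' i k) (at u)" for i k
    using shape_differentiable[OF u] by (simp add: T'_def frechet_derivative_works)
  define T where "T = (\<chi> i k. T' i k z)"
  have "((\<lambda>y. trace (shape y)) has_derivative (\<lambda>h. \<Sum>i\<in>UNIV. T' i i h)) (at u)"
    unfolding trace_def by (intro has_derivative_sum T')
  then have tr: "trace T = frechet_derivative (\<lambda>y. trace (shape y)) (at u) z"
    by (simp add: frechet_derivative_at[symmetric] trace_def T_def)
  have "d2N u w z = - dF u (T *v w) - d2F u z (shape u *v w)" for w
  proof -
    have expand: "dF y x = (\<Sum>j\<in>UNIV. x $ j *\<^sub>R dF y (axis j 1))" if "y \<in> U" for x y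
      by (rule linear_axis_expansion[OF linear_deriv(1)[OF that]])
    define S' where "S' h = - (\<Sum>j\<in>UNIV. (\<Sum>k\<in>UNIV. shape u $ j $ k * w $ k) *\<^sub>R d2F u (axis j 1) h
        + (\<Sum>k\<in>UNIV. T' j k h * w $ k) *\<^sub>R dF u (axis j 1))" for h
    have "((\<lambda>y. - (\<Sum>j\<in>UNIV. (\<Sum>k\<in>UNIV. shape y $ j $ k * w $ k) *\<^sub>R dF y (axis j 1)))
        has_derivative S') (at u)"
      unfolding S'_def
      by (intro has_derivative_minus has_derivative_sum has_derivative_scaleR deriv u has_derivative_mult_left T')
    then have "((\<lambda>y. dN y w) has_derivative S') (at u)"
    proof (rule has_derivative_transform_within_open[OF _ U u])
      fix y assume y: "y \<in> U"
      have "(\<Sum>j\<in>UNIV. (\<Sum>k\<in>UNIV. shape y $ j $ k * w $ k) *\<^sub>R dF y (axis j 1)) = dF y (shape y *v w)"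
        using expand[OF y, of "shape y *v w"] by (simp add: matrix_vector_mult_def)
      then show "- (\<Sum>j\<in>UNIV. (\<Sum>k\<in>UNIV. shape y $ j $ k * w $ k) *\<^sub>R dF y (axis j 1)) = dN y w"
        by (simp only: dF_shape[OF y] minus_minus)
    qed
    then have "S' = d2N u w" by (rule has_derivative_unique[OF _ deriv(4)[OF u]])
    then have "d2N u w z = - (\<Sum>j\<in>UNIV. (shape u *v w) $ j *\<^sub>R d2F u (axis j 1) z
        + (T *v w) $ j *\<^sub>R dF u (axis j 1))"
      by (simp add: fun_eq_iff S'_def matrix_vector_mult_def T_def)
    also have "\<dots> = - (\<Sum>j\<in>UNIV. (shape u *v w) $ j *\<^sub>R d2F u z (axis j 1)) - dF u (T *v w)"
      by (simp add: sum.distrib expand[OF u, of "T *v w"] d2F_sym[OF u, of z])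
    also have "(\<Sum>j\<in>UNIV. (shape u *v w) $ j *\<^sub>R d2F u z (axis j 1)) = d2F u z (shape u *v w)"
      by (rule linear_axis_expansion[OF linear_deriv(3)[OF u], symmetric])
    finally show ?thesis by simp
  qed
  then show ?thesis by (intro exI[of _ T] conjI allI tr)
qed

text \<open>
  The tangential part of the Laplacian of the normal. The Codazzi equation reduces the left-hand side to
  \<open>\<Sum> \<langle>d2N (w e) (w f), e\<rangle>\<close>, in which the derivative of the shape operator contributes its trace; the
  latter vanishes if the mean curvature is constant.
\<close>

lemma trace_d2N:
  assumes u: "u \<in> U"
    and const: "\<And>y. y \<in> U \<Longrightarrow> trace (shape y) = c"
    and frame: "tangent_frame u E"
    and E: "\<And>e. e \<in> E \<Longrightarrow> dF u (w e) = e"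
    and f: "f \<in> E"
  shows "(\<Sum>e\<in>E. d2N u (w e) (w e) \<bullet> f) = (\<Sum>e\<in>E. dN u (w f) \<bullet> d2F u (w e) (w e))"
proof -
  note lin = linear_deriv(1)[OF u]
  have inj: "inj (dF u)" by (rule inj_dF'[OF u])
  note expand_dN = dN_frame_expand[OF u frame]
  have inner_dN: "dN u x \<bullet> y = (\<Sum>e\<in>E. (dN u x \<bullet> e) * (y \<bullet> e))" for x y
  proof -
    have "dN u x \<bullet> y = (\<Sum>e\<in>E. (dN u x \<bullet> e) *\<^sub>R e) \<bullet> y" by (rule arg_cong[OF expand_dN])
    then show ?thesis by (simp add: inner_sum_left inner_commute[of y])
  qed
  have "frechet_derivative (\<lambda>y. trace (shape y)) (at u) = (\<lambda>h. 0)"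
  proof (rule frechet_derivative_at[symmetric])
    show "((\<lambda>y. trace (shape y)) has_derivative (\<lambda>h. 0)) (at u)"
      by (rule has_derivative_transform_within_open[OF has_derivative_const[of c] U u])
        (rule const[symmetric])
  qed
  then have "\<exists>T. trace T = 0 \<and> (\<forall>x. d2N u x (w f) = - dF u (T *v x) - d2F u (w f) (shape u *v x))"
    using d2N_via_shape[OF u, of "w f"] by simp
  then obtain T where T: "trace T = 0"
    "\<And>x. d2N u x (w f) = - dF u (T *v x) - d2F u (w f) (shape u *v x)"
    by blast
  have trace_T: "(\<Sum>e\<in>E. dF u (T *v w e) \<bullet> e) = 0"
    using trace_eq_sum_frame[where D = "dF u" and w = w and R = T,
        OF lin inj E dF_frame_expand[OF u frame]] T(1) by simp
  have S: "shape u *v x = - (\<Sum>k\<in>E. (dN u x \<bullet> k) *\<^sub>R w k)" for x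
  proof (rule injD[OF inj])
    have "dF u (- (\<Sum>k\<in>E. (dN u x \<bullet> k) *\<^sub>R w k)) = - (\<Sum>k\<in>E. (dN u x \<bullet> k) *\<^sub>R k)"
      by (simp add: linear_neg[OF lin] linear_sum[OF lin] linear_cmul[OF lin] E)
    also have "\<dots> = - dN u x" by (rule arg_cong[OF expand_dN[symmetric]])
    finally show "dF u (shape u *v x) = dF u (- (\<Sum>k\<in>E. (dN u x \<bullet> k) *\<^sub>R w k))"
      by (simp add: dF_shape u)
  qed
  have h: "dN u (w e) \<bullet> k = dN u (w k) \<bullet> e" if "e \<in> E" "k \<in> E" for e k
    using second_fundamental_form_sym[OF u, of "w e" "w k"] that by (simp add: E)
  have "(\<Sum>e\<in>E. d2F u (w f) (shape u *v w e) \<bullet> e)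
      = - (\<Sum>e\<in>E. \<Sum>k\<in>E. (dN u (w e) \<bullet> k) * (d2F u (w f) (w k) \<bullet> e))"
    by (simp add: S linear_neg[OF linear_deriv(3)[OF u]] linear_sum[OF linear_deriv(3)[OF u]]
        linear_cmul[OF linear_deriv(3)[OF u]] inner_sum_left sum_negf)
  also have "(\<Sum>e\<in>E. \<Sum>k\<in>E. (dN u (w e) \<bullet> k) * (d2F u (w f) (w k) \<bullet> e))
      = (\<Sum>k\<in>E. \<Sum>e\<in>E. (dN u (w k) \<bullet> e) * (d2F u (w f) (w k) \<bullet> e))"
    by (subst sum.swap) (intro sum.cong refl, simp add: h)
  also have "\<dots> = (\<Sum>k\<in>E. dN u (w k) \<bullet> d2F u (w f) (w k))"
    by (simp flip: inner_dN)
  finally have "(\<Sum>e\<in>E. d2N u (w e) (w f) \<bullet> e) = (\<Sum>e\<in>E. dN u (w e) \<bullet> d2F u (w f) (w e))"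
    using trace_T by (simp add: T(2) inner_diff_left sum_subtractf sum_negf)
  moreover have "(\<Sum>e\<in>E. d2N u (w e) (w e) \<bullet> f) + (\<Sum>e\<in>E. dN u (w e) \<bullet> d2F u (w f) (w e))
      = (\<Sum>e\<in>E. d2N u (w e) (w f) \<bullet> e) + (\<Sum>e\<in>E. dN u (w f) \<bullet> d2F u (w e) (w e))"
    unfolding sum.distrib[symmetric]
  proof (rule sum.cong[OF refl])
    fix e assume "e \<in> E"
    then show "d2N u (w e) (w e) \<bullet> f + dN u (w e) \<bullet> d2F u (w f) (w e)
      = d2N u (w e) (w f) \<bullet> e + dN u (w f) \<bullet> d2F u (w e) (w e)"
      using codazzi[OF u, of "w e" "w e" "w f"] d2N_sym[OF u, of "w f" "w e"] f by (simp add: E)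
  qed
  ultimately show ?thesis by simp
qed

text \<open>
  A positive value of the normal component of the Killing field \<open>B\<close> is never its minimum over a
  patch of constant mean curvature.
\<close>

theorem no_positive_minimum:
  assumes u: "u \<in> U"
    and const: "\<And>y. y \<in> U \<Longrightarrow> trace (shape y) = c"
    and B: "linear B" "\<And>x y. B x \<bullet> y = - (x \<bullet> B y)"
    and pos: "N u \<bullet> B (F u) > 0"
  shows "\<exists>y\<in>U. N y \<bullet> B (F y) < N u \<bullet> B (F u)"
proof (rule ccontr)
  assume "\<not> (\<exists>y\<in>U. N y \<bullet> B (F y) < N u \<bullet> B (F u))"
  then have min: "N u \<bullet> B (F u) \<le> N y \<bullet> B (F y)" if "y \<in> U" for y
    using that by force
  have bl: "bounded_linear B" using B(1) by (simp add: linear_linear)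
  note BD = bounded_linear.has_derivative[OF bl]
  have g1: "((\<lambda>y. N y \<bullet> B (F y)) has_derivative (\<lambda>h. N y \<bullet> B (dF y h) + dN y h \<bullet> B (F y))) (at y)"
    if "y \<in> U" for y
    by (intro has_derivative_inner BD deriv that)
  have g2: "((\<lambda>y. N y \<bullet> B (dF y w) + dN y w \<bullet> B (F y)) has_derivative
      (\<lambda>h. (N u \<bullet> B (d2F u w h) + dN u h \<bullet> B (dF u w)) + (dN u w \<bullet> B (dF u h) + d2N u w h \<bullet> B (F u)))) (at u)" for w
    by (intro has_derivative_add has_derivative_inner BD deriv u)
  have hess: "0 \<le> d2N u w w \<bullet> B (F u) + 2 * (dN u w \<bullet> B (dF u w)) + N u \<bullet> B (d2F u w w)" for w
    using second_derivative_nonneg_at_local_min[OF U u g1 g2 min, of w] by simp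
  have "(\<lambda>h. N u \<bullet> B (dF u h) + dN u h \<bullet> B (F u)) = (\<lambda>h. 0)"
    by (rule differential_zero_maxmin[OF u U g1[OF u]]) (use min in blast)
  then have crit: "dN u h \<bullet> B (F u) + N u \<bullet> B (dF u h) = 0" for h
    by (simp add: fun_eq_iff add.commute)
  obtain E where frame: "tangent_frame u E" using tangent_frame_exists[OF u] by blast
  note E = tangent_frameD[OF frame]
  define w where "w = inv (dF u)"
  have w: "dF u (w e) = e" if "e \<in> E" for e
    unfolding w_def by (rule f_inv_into_f[OF E(3)[OF that]])
  have "0 \<le> (\<Sum>e\<in>E. d2N u (w e) (w e) \<bullet> B (F u) + 2 * (dN u (w e) \<bullet> B e) + N u \<bullet> B (d2F u (w e) (w e)))"
  proof (rule sum_nonneg)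
    fix e assume "e \<in> E"
    then show "0 \<le> d2N u (w e) (w e) \<bullet> B (F u) + 2 * (dN u (w e) \<bullet> B e) + N u \<bullet> B (d2F u (w e) (w e))"
      using hess[of "w e"] w by simp
  qed
  also have "\<dots> = - ((\<Sum>e\<in>E. dN u (w e) \<bullet> dN u (w e)) + card E) * (N u \<bullet> B (F u))"
  proof (rule jacobi_identity_at_critical_point[where nn = "\<lambda>e. d2N u (w e) (w e)" and dn = "\<lambda>e. dN u (w e)"
        and ff = "\<lambda>e. d2F u (w e) (w e)" and B = B, OF B(2) NN[OF u] FF[OF u] NF[OF u] E(4) E(5)[symmetric]])
    fix e assume e: "e \<in> E"
    show "dN u (w e) \<bullet> F u = 0" "dN u (w e) \<bullet> N u = 0"
      by (rule dN_F[OF u], rule dN_N[OF u])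
    show "N u \<bullet> d2F u (w e) (w e) = - (dN u (w e) \<bullet> e)"
      using d2F_N[OF u, of "w e" "w e"] w[OF e] by simp
    show "d2F u (w e) (w e) \<bullet> F u = - (e \<bullet> e)"
      using d2F_F[OF u, of "w e" "w e"] w[OF e] by simp
    show "d2N u (w e) (w e) \<bullet> F u = - (dN u (w e) \<bullet> e)"
      using d2N_F[OF u, of "w e" "w e"] w[OF e] by simp
    show "d2N u (w e) (w e) \<bullet> N u = - (dN u (w e) \<bullet> dN u (w e))"
      by (rule d2N_N[OF u])
    show "(\<Sum>f\<in>E. d2N u (w f) (w f) \<bullet> e) = (\<Sum>f\<in>E. dN u (w e) \<bullet> d2F u (w f) (w f))"
      by (rule trace_d2N[OF u const frame w e])
    show "dN u (w e) \<bullet> B (F u) + N u \<bullet> B e = 0"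
      using crit[of "w e"] w[OF e] by simp
  next
    fix e f assume "e \<in> E" "f \<in> E"
    then show "dN u (w e) \<bullet> f = dN u (w f) \<bullet> e"
      using second_fundamental_form_sym[OF u, of "w e" "w f"] by (simp add: w)
  qed
  also have "\<dots> < 0"
  proof -
    have "0 < (\<Sum>e\<in>E. dN u (w e) \<bullet> dN u (w e)) + card E"
      using E(2) by (intro add_nonneg_pos sum_nonneg) auto
    from mult_pos_pos[OF this pos] show ?thesis
      by (simp only: mult_minus_left neg_less_0_iff_less)
  qed
  finally show False by simp
qed

end

section \<open>Octonionic multiplication and charts\<close>

lemma omult_right_skew:
  assumes "v \<bullet> oone = 0"
  shows "(x \<odot> v) \<bullet> y = - (x \<bullet> (y \<odot> v))"
proof -
  have "v $ 0 = 0" using assms by (simp add: oone_def inner_axis)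
  then show ?thesis unfolding inner_oct omult_nth by (simp add: algebra_simps)
qed

lemma linear_omult_right: "linear (\<lambda>x. x \<odot> v)"
  by (rule linearI) (simp_all add: vec_eq_iff forall_8 omult_nth algebra_simps)

text \<open>
  Left multiplication by the conjugate \<open>oconj x\<close> is adjoint to left multiplication by \<open>x\<close>.
\<close>

lemma octonionic_Gauss_map_inner:
  assumes "norm (f p) = 1"
  shows "octonionic_Gauss_map f \<eta> p \<bullet> v = \<eta> p \<bullet> (f p \<odot> v)"
proof -
  have c: "oconj x $ 0 = x $ 0" "oconj x $ 1 = - x $ 1" "oconj x $ 2 = - x $ 2" "oconj x $ 3 = - x $ 3"
    "oconj x $ 4 = - x $ 4" "oconj x $ 5 = - x $ 5" "oconj x $ 6 = - x $ 6" "oconj x $ 7 = - x $ 7" for x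
    by (simp_all add: oconj_def)
  have "(oconj x \<odot> y) \<bullet> v = y \<bullet> (x \<odot> v)" for x y
    unfolding inner_oct omult_nth c by (simp add: algebra_simps)
  then show ?thesis using assms by (simp add: octonionic_Gauss_map_def oinverse_def)
qed

lemma smooth_manifold_chart:
  assumes "smooth_manifold M A" "(U, \<phi>) \<in> A"
  shows "open U" "openin M (\<phi> ` U)" "homeomorphic_map (top_of_set U) (subtopology M (\<phi> ` U)) \<phi>"
  using assms unfolding smooth_manifold_def by auto

lemma smooth_manifold_topspace:
  assumes "smooth_manifold M A"
  shows "p \<in> topspace M \<longleftrightarrow> (\<exists>(U, \<phi>)\<in>A. \<exists>u\<in>U. p = \<phi> u)"
proof -
  have "topspace M = (\<Union>(U, \<phi>)\<in>A. \<phi> ` U)" using assms unfolding smooth_manifold_def by simp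
  then show ?thesis by (auto simp: image_iff)
qed

lemma continuous_map_from_charts:
  fixes q :: "'a \<Rightarrow> 'c::topological_space"
  assumes "smooth_manifold M A"
    and q: "\<And>U \<phi>. (U, \<phi>) \<in> A \<Longrightarrow> continuous_on U (q \<circ> \<phi>)"
  shows "continuous_map M euclidean q"
proof (rule pasting_lemma[where I = A and T = "\<lambda>(U, \<phi>). \<phi> ` U" and f = "\<lambda>_. q"])
  note chart = smooth_manifold_chart(2,3)[OF assms(1)]
  show "openin M (case i of (U, \<phi>) \<Rightarrow> \<phi> ` U)" if "i \<in> A" for i
    using that chart(1) by (cases i) simp
  show "continuous_map (subtopology M (case i of (U, \<phi>) \<Rightarrow> \<phi> ` U)) euclidean q" if "i \<in> A" for i
  proof (cases i)
    case (Pair U \<phi>)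
    have "quotient_map (top_of_set U) (subtopology M (\<phi> ` U)) \<phi>"
      using chart(2) that Pair unfolding homeomorphic_map_def by blast
    moreover have "continuous_map (top_of_set U) euclidean (q \<circ> \<phi>)"
      using q that Pair by simp
    ultimately show ?thesis
      using continuous_compose_quotient_map_eq Pair by fastforce
  qed
  show "\<exists>j. j \<in> A \<and> x \<in> (case j of (U, \<phi>) \<Rightarrow> \<phi> ` U) \<and> q x = q x" if "x \<in> topspace M" for x
    using that unfolding smooth_manifold_topspace[OF assms(1)] by blast
qed auto

lemma smooth_on_imp_twice_differentiable:
  assumes "smooth_on U F" "u \<in> U"
  shows "F differentiable (at u)" "(\<lambda>y. frechet_derivative F (at y) w) differentiable (at u)"
proof -
  have "Ck_on (Suc (Suc 0)) U F" using assms(1) unfolding smooth_on_def by blast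
  then show "F differentiable (at u)" "(\<lambda>y. frechet_derivative F (at y) w) differentiable (at u)"
    using assms(2) by auto
qed

lemma hypersurface_chart_is_patch:
  assumes "hypersurface_S7 M A f" "unit_normal_field M A f \<eta>" "(U, \<phi>) \<in> A"
  shows "sphere_hypersurface_patch U (f \<circ> \<phi>) (\<eta> \<circ> \<phi>)"
proof
  have M: "smooth_manifold M A" using assms(1) unfolding hypersurface_S7_def by blast
  have top: "\<phi> u \<in> topspace M" if "u \<in> U" for u
    using that assms(3) unfolding smooth_manifold_topspace[OF M] by blast
  have f: "norm (f p) = 1" if "p \<in> topspace M" for p
    using that assms(1) unfolding hypersurface_S7_def S7_def by auto
  have \<eta>: "norm (\<eta> p) = 1" "\<eta> p \<bullet> f p = 0" if "p \<in> topspace M" for p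
    using that assms(2) unfolding unit_normal_field_def by auto
  show "DIM(oct) = CARD(6) + 2" by simp
  show "open U" by (rule smooth_manifold_chart(1)[OF M assms(3)])
  fix u assume u: "u \<in> U"
  have F: "smooth_on U (f \<circ> \<phi>)" "inj (frechet_derivative (f \<circ> \<phi>) (at u))"
    using assms(1,3) u unfolding hypersurface_S7_def by auto
  have N: "smooth_on U (\<eta> \<circ> \<phi>)" "(\<eta> \<circ> \<phi>) u \<bullet> frechet_derivative (f \<circ> \<phi>) (at u) w = 0" for w
    using assms(2,3) u unfolding unit_normal_field_def by auto
  show "(f \<circ> \<phi>) differentiable (at u)" "(\<eta> \<circ> \<phi>) differentiable (at u)"
    "(\<lambda>u. frechet_derivative (f \<circ> \<phi>) (at u) w) differentiable (at u)"
    "(\<lambda>u. frechet_derivative (\<eta> \<circ> \<phi>) (at u) w) differentiable (at u)" for w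
    using smooth_on_imp_twice_differentiable F(1) N(1) u by blast+
  show "inj (frechet_derivative (f \<circ> \<phi>) (at u))"
    "(\<eta> \<circ> \<phi>) u \<bullet> frechet_derivative (f \<circ> \<phi>) (at u) w = 0" for w
    by (fact F N)+
  show "(f \<circ> \<phi>) u \<bullet> (f \<circ> \<phi>) u = 1" "(\<eta> \<circ> \<phi>) u \<bullet> (\<eta> \<circ> \<phi>) u = 1" "(\<eta> \<circ> \<phi>) u \<bullet> (f \<circ> \<phi>) u = 0"
    using f \<eta> top[OF u] by (simp_all add: norm_eq_1)
qed

theorem theorem4:
  fixes M :: "'a topology"
    and A :: "(real^6, 'a) atlas"
    and f \<eta> :: "'a \<Rightarrow> oct"
  assumes "hypersurface_S7 M A f"
    and "compact_space M" and "topspace M \<noteq> {}"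
    and "unit_normal_field M A f \<eta>"
    and "constant_mean_curvature A f \<eta>"
  shows "\<not> (\<exists>v\<in>S6. octonionic_Gauss_map f \<eta> ` topspace M \<subseteq> open_hemisphere v)"
proof
  assume "\<exists>v\<in>S6. octonionic_Gauss_map f \<eta> ` topspace M \<subseteq> open_hemisphere v"
  then obtain v where v: "v \<bullet> oone = 0"
    and hemi: "\<And>p. p \<in> topspace M \<Longrightarrow> octonionic_Gauss_map f \<eta> p \<bullet> v > 0"
    unfolding S6_def open_hemisphere_def by blast
  define q where "q p = \<eta> p \<bullet> (f p \<odot> v)" for p
  have pos: "q p > 0" if "p \<in> topspace M" for p
    using hemi[OF that] octonionic_Gauss_map_inner[of f p \<eta> v] assms(1) that
    unfolding hypersurface_S7_def S7_def q_def by auto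
  have M: "smooth_manifold M A" using assms(1) unfolding hypersurface_S7_def by blast
  have bl: "bounded_linear (\<lambda>x. x \<odot> v)" using linear_omult_right by (simp add: linear_linear)
  have "continuous_on U (q \<circ> \<phi>)" if "(U, \<phi>) \<in> A" for U \<phi>
  proof -
    interpret sphere_hypersurface_patch U "f \<circ> \<phi>" "\<eta> \<circ> \<phi>"
      by (rule hypersurface_chart_is_patch[OF assms(1,4) that])
    have "continuous_on U (f \<circ> \<phi>)" "continuous_on U (\<eta> \<circ> \<phi>)"
      by (intro continuous_at_imp_continuous_on ballI differentiable_imp_continuous_within F1 N1; assumption)+
    then have "continuous_on U (\<lambda>u. (\<eta> \<circ> \<phi>) u \<bullet> ((f \<circ> \<phi>) u \<odot> v))"
      by (intro continuous_on_inner bounded_linear.continuous_on[OF bl])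
    then show ?thesis by (simp add: q_def o_def)
  qed
  with M have "continuous_map M euclidean q" by (rule continuous_map_from_charts)
  then have "compact (q ` topspace M)"
    using image_compactin[of M "topspace M" euclidean q] assms(2) by (simp add: compact_space_def)
  then obtain p where p: "p \<in> topspace M" and min: "\<And>p'. p' \<in> topspace M \<Longrightarrow> q p \<le> q p'"
    using compact_attains_inf[of "q ` topspace M"] assms(3) by auto
  obtain U \<phi> u where chart: "(U, \<phi>) \<in> A" and u: "u \<in> U" "p = \<phi> u"
    using p unfolding smooth_manifold_topspace[OF M] by blast
  interpret sphere_hypersurface_patch U "f \<circ> \<phi>" "\<eta> \<circ> \<phi>"
    by (rule hypersurface_chart_is_patch[OF assms(1,4) chart])
  obtain H where H: "\<And>y. y \<in> U \<Longrightarrow> mean_curvature (f \<circ> \<phi>) (\<eta> \<circ> \<phi>) y = H"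
    using assms(5) chart unfolding constant_mean_curvature_def by blast
  have "trace (shape y) = 6 * H" if "y \<in> U" for y
    using H[OF that] unfolding mean_curvature_def shape_def shape_operator_def[abs_def] dF_def dN_def by simp
  from no_positive_minimum[OF u(1) this linear_omult_right omult_right_skew[OF v]]
  obtain y where "y \<in> U" "q (\<phi> y) < q p"
    using pos[OF p] u(2) by (auto simp: q_def)
  moreover have "\<phi> y \<in> topspace M" using chart \<open>y \<in> U\<close> unfolding smooth_manifold_topspace[OF M] by blast
  ultimately show False using min by fastforce
qed

end
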